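(* There exists an integer $n_0$ such that for all integers $n\ge n_0$ and $m\ge 3$, there exist families $\mathcal{B},\mathcal{R}\subset\mathcal{Q}_{n+m}$ with $\mathcal{B}\cap\mathcal{R}=\emptyset$ and $\mathcal{B}\cup\mathcal{R}=\mathcal{Q}_{n+m}$ such that $\mathcal{Q}_m$ is not a weak subposet of $\mathcal{B}$ and $\mathcal{Q}_n$ is not a weak subposet of $\mathcal{R}$ (where $\mathcal{B}$ and $\mathcal{R}$ are ordered by inclusion).
   Context: For a positive integer $N$, the Boolean lattice $\mathcal{Q}_N$ is the power set of $[N]=\{1,\dots,N\}$ ordered by inclusion. For posets $P$ and $Q$, $P$ is a weak subposet of $Q$ if there is an injection $f:P\to Q$ such that $f(x)\le f(y)$ whenever $x\le y$. *)

theory Defs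
  imports Main
begin

(* Posets are subsets of a type of class order, with the induced order; on sets this is inclusion. *)

definition boolean_lattice :: "nat \<Rightarrow> nat set set" where
  "boolean_lattice N = Pow {1..N}"

definition weak_subposet :: "'a::order set \<Rightarrow> 'b::order set \<Rightarrow> bool" where
  "weak_subposet P Q \<longleftrightarrow> (\<exists>f. inj_on f P \<and> f ` P \<subseteq> Q \<and> mono_on P f)"

end

theory Submission
  imports Defs
begin

text \<open>
  After exchanging the colours we may assume \<open>m \<le> n\<close>. Fix a family \<open>H\<close> and colour blue all sets
  with 2 elements, those with at least \<open>n + 2\<close> elements, and the 3-element sets in \<open>H\<close>; all
  other sets are red. The blue sets occupy \<open>m + 1\<close> layers and the red ones \<open>n + 1\<close> layers, so a
  monochromatic copy meets every layer of its colour. A blue \<open>Q\<^sub>m\<close> sends the empty set to a pair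
  and the singletons to \<open>m\<close> triples of \<open>H\<close> containing it. In a red \<open>Q\<^sub>n\<close> the layers from 3 to
  \<open>n + 1\<close> are consecutive, which forces the 2-element sets to be sent to all triples
  \<open>{w, a, b}\<close> with \<open>a\<close>, \<open>b\<close> in some \<open>n\<close>-element set. Both are impossible if
  \<open>H\<close> consists of the sets whose sum is divisible by \<open>q\<close>, where \<open>q = n + m\<close> if \<open>n\<close> is larger than
  \<open>m + 3\<close>, and \<open>q = 3\<close> otherwise.
\<close>

section \<open>Growth of cardinalities along chains\<close>

text \<open>Adding the elements of \<open>Y - X\<close> one at a time enlarges the image strictly at
  each step, since \<open>f\<close> is monotone and injective. This is what pins the layers of a
  monochromatic copy.\<close>

lemma card_image_gap:
  fixes f :: "'a set \<Rightarrow> 'b set"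
  assumes "finite K" "finite U" "inj_on f (Pow K)" "mono_on (Pow K) f" "f ` Pow K \<subseteq> Pow U"
    and "X \<subseteq> Y" "Y \<subseteq> K"
  shows "card (f X) + card (Y - X) \<le> card (f Y)"
proof -
  have "card (f X) + card D \<le> card (f (X \<union> D))" if "finite D" "D \<subseteq> Y - X" for D
    using that
  proof (induction D)
    case empty
    then show ?case by simp
  next
    case (insert d D)
    have sub: "X \<union> D \<in> Pow K" "X \<union> insert d D \<in> Pow K" "X \<union> D \<noteq> X \<union> insert d D"
      using insert assms by auto
    have "f (X \<union> D) \<subseteq> f (X \<union> insert d D)"
      using mono_onD[OF assms(4) sub(1,2)] by auto
    moreover have "f (X \<union> D) \<noteq> f (X \<union> insert d D)"
      using inj_onD[OF assms(3)] sub by blast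
    moreover have "finite (f (X \<union> insert d D))"
      using assms(2,5) sub(2) by (meson PowD finite_subset image_subset_iff)
    ultimately have "card (f (X \<union> D)) < card (f (X \<union> insert d D))"
      by (intro psubset_card_mono) auto
    then show ?case using insert by auto
  qed
  from this[of "Y - X"] show ?thesis
    using assms by (simp add: Un_absorb1 finite_subset)
qed

section \<open>Colourings determined by a family of triples\<close>

text \<open>Collects what is asked of \<open>H\<close>: few triples of \<open>H\<close> over each
  pair (\<open>codegree\<close>) excludes a blue copy; the absence of an independent
  \<open>n\<close>-set in the link graph of any point \<open>w\<close> (\<open>link\<close>)
  excludes a red one.\<close>

locale triple_coloring =
  fixes n m :: nat and H :: "nat set set"
  assumes n3: "3 \<le> n" and m1: "1 \<le> m"
    and codegree: "\<And>S. S \<subseteq> {1..n + m} \<Longrightarrow> card S = 2 \<Longrightarrow>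
      card {z \<in> {1..n + m}. z \<notin> S \<and> insert z S \<in> H} < m"
    and link: "\<And>w A. A \<subseteq> {1..n + m} \<Longrightarrow> w \<in> {1..n + m} \<Longrightarrow> w \<notin> A \<Longrightarrow> card A = n \<Longrightarrow>
      \<exists>a\<in>A. \<exists>b\<in>A. a \<noteq> b \<and> {w, a, b} \<in> H"
begin

definition blue :: "nat set set" where
  "blue = {X \<in> boolean_lattice (n + m). card X = 2 \<or> card X = 3 \<and> X \<in> H \<or> n + 2 \<le> card X}"

definition red :: "nat set set" where
  "red = boolean_lattice (n + m) - blue"

lemma no_blue_copy: "\<not> weak_subposet (boolean_lattice m) blue"
proof
  assume "weak_subposet (boolean_lattice m) blue"
  then obtain f :: "nat set \<Rightarrow> nat set" where f: "inj_on f (Pow {1..m})"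
    "f ` Pow {1..m} \<subseteq> blue" "mono_on (Pow {1..m}) f"
    unfolding weak_subposet_def boolean_lattice_def by auto
  have fU: "f ` Pow {1..m} \<subseteq> Pow {1..n + m}"
    using f(2) unfolding blue_def boolean_lattice_def by auto
  note gap = card_image_gap[OF _ _ f(1,3) fU, simplified]
  have bl: "f X \<in> blue" if "X \<subseteq> {1..m}" for X
    using f(2) that by auto
  have top: "card (f {1..m}) \<le> n + m"
    using fU card_mono[of "{1..n + m}" "f {1..m}"] by auto
  have single: "card (f {}) = 2 \<and> card (f {x}) = 3 \<and> f {x} \<in> H \<and> f {} \<subseteq> f {x}"
    if x: "x \<in> {1..m}" for x
  proof -
    \<comment> \<open>The remaining \<open>m - 1\<close> elements still have to fit above
      \<open>f {x}\<close>, so it stays below the top blue layers. Only the sizes 2 and 3 are left,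
      and strict growth from \<open>f {}\<close> uses both.\<close>
    have "card (f {x}) + (m - 1) \<le> n + m"
      using gap[of "{x}" "{1..m}"] top x by auto
    then have "card (f {x}) \<le> n + 1" using x by auto
    moreover have "card (f {}) + 1 \<le> card (f {x})"
      using gap[of "{}" "{x}"] x by simp
    moreover have "f {} \<subseteq> f {x}"
      using mono_onD[OF f(3), of "{}" "{x}"] x by auto
    ultimately show ?thesis
      using bl[of "{}"] bl[of "{x}"] x unfolding blue_def by auto
  qed
  define S where "S = f {}"
  have S: "card S = 2" "S \<subseteq> {1..n + m}" "finite S"
    using single[of 1] m1 fU unfolding S_def by (auto intro: card_ge_0_finite)
  have "\<exists>z. z \<notin> S \<and> f {x} = insert z S" if "x \<in> {1..m}" for x
  proof -
    have "card (f {x} - S) = 1"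
      using single[OF that] S(3) by (subst card_Diff_subset) (auto simp: S_def)
    then obtain z where "f {x} - S = {z}"
      by (auto simp: card_1_singleton_iff)
    then show ?thesis using single[OF that] unfolding S_def by blast
  qed
  then obtain t where t: "\<And>x. x \<in> {1..m} \<Longrightarrow> t x \<notin> S \<and> f {x} = insert (t x) S"
    by metis
  have "inj_on t {1..m}"
  proof (rule inj_onI)
    fix x y assume "x \<in> {1..m}" "y \<in> {1..m}" "t x = t y"
    then show "x = y"
      using t[of x] t[of y] inj_onD[OF f(1), of "{x}" "{y}"] by auto
  qed
  moreover have "t ` {1..m} \<subseteq> {z \<in> {1..n + m}. z \<notin> S \<and> insert z S \<in> H}"
  proof (rule image_subsetI)
    fix x assume x: "x \<in> {1..m}"
    have "f {x} \<subseteq> {1..n + m}"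
      using fU x by (metis PowD PowI bot.extremum image_subset_iff insert_subset)
    then show "t x \<in> {z \<in> {1..n + m}. z \<notin> S \<and> insert z S \<in> H}"
      using t[OF x] single[OF x] by auto
  qed
  ultimately have "card {1..m} \<le> card {z \<in> {1..n + m}. z \<notin> S \<and> insert z S \<in> H}"
    by (intro card_inj_on_le) auto
  with codegree[OF S(2,1)] show False by simp
qed

lemma no_red_copy: "\<not> weak_subposet (boolean_lattice n) red"
proof
  assume "weak_subposet (boolean_lattice n) red"
  then obtain f :: "nat set \<Rightarrow> nat set" where f: "inj_on f (Pow {1..n})"
    "f ` Pow {1..n} \<subseteq> red" "mono_on (Pow {1..n}) f"
    unfolding weak_subposet_def boolean_lattice_def by auto
  have fU: "f ` Pow {1..n} \<subseteq> Pow {1..n + m}"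
    using f(2) unfolding red_def boolean_lattice_def by auto
  note gap = card_image_gap[OF _ _ f(1,3) fU, simplified]
  have rd: "card (f X) \<noteq> 2 \<and> (card (f X) = 3 \<longrightarrow> f X \<notin> H) \<and> card (f X) \<le> n + 1"
    if "X \<subseteq> {1..n}" for X
  proof -
    have "f X \<in> red" using f(2) that by auto
    then show ?thesis unfolding red_def blue_def by auto
  qed
  have fin: "finite (f X)" if "X \<subseteq> {1..n}" for X
    using fU that by (meson PowI PowD finite_atLeastAtMost finite_subset image_subset_iff)
  \<comment> \<open>There is no slack: a pair has an image of size at least 2, hence at least 3
    because layer 2 is blue, while the full set has an image of size at most
    \<open>n + 1\<close>.\<close>
  have level: "card (f X) = card X + 1" if X: "X \<subseteq> {1..n}" "2 \<le> card X" for X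
  proof -
    obtain P where P: "P \<subseteq> X" "card P = 2" "finite P"
      using obtain_subset_with_card_n[OF X(2)] by auto
    have Pn: "P \<subseteq> {1..n}" using P X by auto
    have "card P \<le> card (f P)"
      using gap[of "{}" P] P Pn by simp
    moreover have "card (f P) \<noteq> 2"
      using rd[OF Pn] by auto
    moreover have "card (f P) + (card X - 2) \<le> card (f X)"
      using gap[of P X] P X card_Diff_subset[of P X] by simp
    moreover have "card (f X) + (n - card X) \<le> n + 1"
      using gap[of X "{1..n}"] X rd[of "{1..n}"] card_Diff_subset[of X "{1..n}"]
      by (simp add: finite_subset)
    moreover have "card X \<le> n"
      using card_mono[of "{1..n}" X] X by simp
    ultimately show ?thesis using X(2) P(2) by linarith
  qed
  define V where "V = f {1..n}"
  have V: "card V = n + 1" "finite V" "V \<subseteq> {1..n + m}"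
    using level[of "{1..n}"] n3 fin[of "{1..n}"] fU unfolding V_def by auto
  \<comment> \<open>Coatoms go to coatoms of \<open>V\<close>; the points that they omit label the
    elements of \<open>{1..n}\<close> inside \<open>V\<close>.\<close>
  have "\<exists>v. v \<in> V \<and> f ({1..n} - {x}) = V - {v}" if x: "x \<in> {1..n}" for x
  proof -
    have "card (f ({1..n} - {x})) = n"
      using level[of "{1..n} - {x}"] x n3 by simp
    moreover have sub: "f ({1..n} - {x}) \<subseteq> V"
      using mono_onD[OF f(3), of "{1..n} - {x}" "{1..n}"] unfolding V_def by auto
    ultimately have "card (V - f ({1..n} - {x})) = 1"
      using V fin[of "{1..n} - {x}"] by (subst card_Diff_subset) auto
    then obtain v where "V - f ({1..n} - {x}) = {v}"
      by (auto simp: card_1_singleton_iff)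
    then show ?thesis using sub by (intro exI[of _ v]) blast
  qed
  then obtain t where t: "\<And>x. x \<in> {1..n} \<Longrightarrow> t x \<in> V \<and> f ({1..n} - {x}) = V - {t x}"
    by metis
  have inj: "inj_on t {1..n}"
  proof (rule inj_onI)
    fix x y assume xy: "x \<in> {1..n}" "y \<in> {1..n}" "t x = t y"
    then have "{1..n} - {x} = {1..n} - {y}"
      using t[of x] t[of y] inj_onD[OF f(1), of "{1..n} - {x}" "{1..n} - {y}"] by auto
    then show "x = y" using xy by blast
  qed
  define A where "A = t ` {1..n}"
  have A: "A \<subseteq> V" "card A = n" "finite A"
    using t inj unfolding A_def by (auto simp: card_image)
  then have "card (V - A) = 1"
    using V by (subst card_Diff_subset) auto
  \<comment> \<open>Exactly one of the \<open>n + 1\<close> points of \<open>V\<close> is omitted by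
    no coatom; its link supplies the forbidden triple.\<close>
  then obtain w where w: "V - A = {w}"
    by (auto simp: card_1_singleton_iff)
  obtain a b where ab: "a \<in> A" "b \<in> A" "a \<noteq> b" "{w, a, b} \<in> H"
    using link[of A w] A V w by blast
  then obtain x y where xy: "x \<in> {1..n}" "y \<in> {1..n}" "t x = a" "t y = b" "x \<noteq> y"
    unfolding A_def by blast
  \<comment> \<open>For each \<open>z\<close> other than \<open>x\<close> and \<open>y\<close>, the
    set \<open>{x, y}\<close> lies below the coatom without \<open>z\<close>, so its image avoids
    \<open>t z\<close>.\<close>
  have "f {x, y} \<subseteq> {w, a, b}"
  proof
    fix v assume v: "v \<in> f {x, y}"
    have "f {x, y} \<subseteq> V"
      using mono_onD[OF f(3), of "{x, y}" "{1..n}"] xy unfolding V_def by auto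
    moreover have "v \<noteq> t z" if z: "z \<in> {1..n}" "z \<notin> {x, y}" for z
      using mono_onD[OF f(3), of "{x, y}" "{1..n} - {z}"] xy z t[of z] v by auto
    ultimately show "v \<in> {w, a, b}"
      using v w xy unfolding A_def by blast
  qed
  moreover have "card (f {x, y}) = 3"
    using level[of "{x, y}"] xy by simp
  moreover have "card {w, a, b} = 3"
    using w ab by (auto simp: card_insert_if)
  ultimately have "f {x, y} = {w, a, b}"
    by (intro card_subset_eq) auto
  with rd[of "{x, y}"] xy ab \<open>card (f {x, y}) = 3\<close> show False by simp
qed

lemma ex_coloring:
  "\<exists>B R :: nat set set.
    B \<subseteq> boolean_lattice (n + m) \<and> R \<subseteq> boolean_lattice (n + m) \<and>
    B \<inter> R = {} \<and> B \<union> R = boolean_lattice (n + m) \<and>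
    \<not> weak_subposet (boolean_lattice m) B \<and> \<not> weak_subposet (boolean_lattice n) R"
  using no_blue_copy no_red_copy
  by (intro exI[of _ blue] exI[of _ red]) (auto simp: red_def blue_def)

end

section \<open>Residue classes in an initial interval\<close>

lemma dvd_add_imp_dvd_diff:
  fixes q c x y :: nat
  assumes "q dvd c + x" "q dvd c + y"
  shows "int q dvd int x - int y"
proof -
  have "int q dvd int (c + x) - int (c + y)"
    using assms by (intro dvd_diff) (simp_all only: int_dvd_int_iff)
  then show ?thesis by simp
qed

lemma inj_on_div_residue_class:
  fixes q c :: nat
  shows "inj_on (\<lambda>z. (c + z) div q) {z. q dvd c + z}"
  by (rule inj_onI) (metis add_left_cancel dvd_mult_div_cancel mem_Collect_eq)

text \<open>The quotients \<open>(c + z) div q\<close> are distinct on the class and lie in an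
  interval of \<open>N div q + 2\<close> integers; one of these allows for the carry from the
  remainders of \<open>c\<close> and \<open>N\<close>.\<close>

lemma card_residue_class_le:
  fixes q c N :: nat
  assumes "0 < q"
  shows "card {z \<in> {1..N}. q dvd c + z} \<le> N div q + 2"
proof -
  have "card {z \<in> {1..N}. q dvd c + z} \<le> card {c div q..c div q + (N div q + 1)}"
  proof (rule card_inj_on_le[where f = "\<lambda>z. (c + z) div q"])
    show "inj_on (\<lambda>z. (c + z) div q) {z \<in> {1..N}. q dvd c + z}"
      by (rule inj_on_subset[OF inj_on_div_residue_class]) auto
    have "(c + z) div q \<le> c div q + (N div q + 1)" if "z \<le> N" for z
    proof -
      have "(c + z) div q \<le> (c + N) div q" using that by (simp add: div_le_mono)
      also have "\<dots> = c div q + N div q + (c mod q + N mod q) div q"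
        by (rule div_add1_eq)
      also have "(c mod q + N mod q) div q \<le> 1"
      proof -
        have "c mod q + N mod q < 2 * q"
          using mod_less_divisor[OF assms, of c] mod_less_divisor[OF assms, of N] by linarith
        then show ?thesis using less_mult_imp_div_less by fastforce
      qed
      finally show ?thesis by simp
    qed
    then show "(\<lambda>z. (c + z) div q) ` {z \<in> {1..N}. q dvd c + z}
        \<subseteq> {c div q..c div q + (N div q + 1)}"
      by (auto simp: div_le_mono)
  qed simp
  then show ?thesis by simp
qed

lemma residue_class_unique:
  fixes x y N c :: nat
  assumes "x \<in> {1..N}" "y \<in> {1..N}" "N dvd c + x" "N dvd c + y"
  shows "x = y"
proof -
  have "int N dvd int x - int y" by (rule dvd_add_imp_dvd_diff[OF assms(3,4)])
  moreover have "\<bar>int x - int y\<bar> < int N" using assms(1,2) by auto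
  ultimately show ?thesis using dvd_imp_le_int[of "int x - int y" "int N"] by force
qed

lemma sum_triple:
  fixes w a b :: nat
  assumes "w \<noteq> a" "w \<noteq> b" "a \<noteq> b"
  shows "\<Sum> {w, a, b} = w + a + b"
  using assms by simp

section \<open>Two families of triples given by divisibility of sums\<close>

text \<open>Two elements of a triple determine the third modulo \<open>n + m\<close>, so every
  codegree is at most 1. For the link, completing \<open>w\<close>, \<open>a\<close> to a zero-sum
  triple gives an injection \<open>p\<close>; if it never paired distinct elements of
  \<open>A\<close>, it would send all but its fixed points into the \<open>m\<close> points outside
  \<open>A\<close>.\<close>

lemma triple_coloring_mod_sum:
  assumes "m + 4 \<le> n" "3 \<le> m"
  shows "triple_coloring n m {X. n + m dvd \<Sum> X}"
proof
  show "3 \<le> n" "1 \<le> m" using assms by auto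
next
  let ?N = "n + m"
  fix S :: "nat set" assume S: "S \<subseteq> {1..?N}" "card S = 2"
  then have "finite S" using finite_subset by auto
  then have "\<forall>x\<in>{z \<in> {1..?N}. z \<notin> S \<and> insert z S \<in> {X. ?N dvd \<Sum> X}}.
     \<forall>y\<in>{z \<in> {1..?N}. z \<notin> S \<and> insert z S \<in> {X. ?N dvd \<Sum> X}}. x = y"
    using residue_class_unique[of _ ?N _ "\<Sum> S"] by (auto simp: add.commute)
  then have "card {z \<in> {1..?N}. z \<notin> S \<and> insert z S \<in> {X. ?N dvd \<Sum> X}} \<le> 1"
    by (subst card_le_Suc0_iff_eq[unfolded One_nat_def[symmetric]]) auto
  then show "card {z \<in> {1..?N}. z \<notin> S \<and> insert z S \<in> {X. ?N dvd \<Sum> X}} < m"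
    using assms by linarith
next
  let ?N = "n + m"
  fix w A assume A: "A \<subseteq> {1..?N}" "w \<in> {1..?N}" "w \<notin> A" "card A = n"
  have N: "0 < ?N" using assms by simp
  \<comment> \<open>Subtracting the remainder from \<open>?N\<close> gives the representative in
    \<open>{1..?N}\<close>: remainder 0 yields \<open>?N\<close>, not 0.\<close>
  define p where "p a = ?N - (w + a) mod ?N" for a
  have p: "p a \<in> {1..?N}" "?N dvd w + a + p a" for a
  proof -
    have "(w + a) mod ?N < ?N" using N by simp
    then show "p a \<in> {1..?N}" unfolding p_def by auto
    have "w + a + p a = ?N * ((w + a) div ?N) + ?N"
      using mult_div_mod_eq[of ?N "w + a"] \<open>(w + a) mod ?N < ?N\<close> unfolding p_def by linarith
    then show "?N dvd w + a + p a" by simp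
  qed
  have inj: "inj_on p {1..?N}"
  proof (rule inj_onI)
    fix x y assume xy: "x \<in> {1..?N}" "y \<in> {1..?N}" "p x = p y"
    have "?N dvd w + p x + x" "?N dvd w + p x + y"
      using p(2)[of x] p(2)[of y] xy(3) by (simp_all add: ac_simps)
    then show "x = y" by (rule residue_class_unique[OF xy(1,2)])
  qed
  have "\<exists>a\<in>A. p a \<in> A \<and> p a \<noteq> a"
  proof (rule ccontr)
    assume neg: "\<not> ?thesis"
    define F where "F = {a \<in> A. p a = a}"
    have fA: "finite A" using A(1) finite_subset by auto
    have "card (A - F) \<le> card ({1..?N} - A)"
    proof (rule card_inj_on_le[where f = p])
      show "inj_on p (A - F)" by (rule inj_on_subset[OF inj]) (use A in auto)
      show "p ` (A - F) \<subseteq> {1..?N} - A"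
        using neg p(1) unfolding F_def by blast
    qed simp
    also have "\<dots> = m" using A fA by (subst card_Diff_subset) auto
    finally have "n \<le> m + card F"
      using A(4) fA card_Diff_subset[of F A] unfolding F_def by simp
    \<comment> \<open>At a fixed point, \<open>w + 2 * a\<close> is one of \<open>?N\<close>,
      \<open>2 * ?N\<close>, \<open>3 * ?N\<close>, so there are at most 3; hence the gap of 4
      between \<open>m\<close> and \<open>n\<close>.\<close>
    moreover have "card F \<le> card {1..3::nat}"
    proof (rule card_inj_on_le[where f = "\<lambda>a. (w + 2 * a) div ?N"])
      have dvdF: "?N dvd w + 2 * a" if "a \<in> F" for a
        using p(2)[of a] that unfolding F_def by (simp add: mult_2 add.assoc)
      show "inj_on (\<lambda>a. (w + 2 * a) div ?N) F"
      proof (rule inj_onI)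
        fix a b assume ab: "a \<in> F" "b \<in> F" "(w + 2 * a) div ?N = (w + 2 * b) div ?N"
        have "w + 2 * a = w + 2 * b"
          using dvd_div_mult_self[OF dvdF[OF ab(1)]] dvd_div_mult_self[OF dvdF[OF ab(2)]] ab(3)
          by metis
        then show "a = b" by simp
      qed
      show "(\<lambda>a. (w + 2 * a) div ?N) ` F \<subseteq> {1..3}"
      proof (rule image_subsetI)
        fix a assume a: "a \<in> F"
        then have "a \<in> {1..?N}" using A unfolding F_def by auto
        then have "w + 2 * a \<le> 3 * ?N" "0 < w + 2 * a" using A(2) by auto
        moreover obtain k where k: "w + 2 * a = ?N * k" using dvdF[OF a] by blast
        ultimately have "?N * k \<le> ?N * 3" "k \<noteq> 0" by (simp_all only: mult.commute) auto
        then have "k \<le> 3" "0 < k" using N mult_le_cancel1[of ?N k 3] by blast+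
        then show "(w + 2 * a) div ?N \<in> {1..3}" using k N by simp
      qed
    qed simp
    ultimately show False using assms by simp
  qed
  then obtain a where a: "a \<in> A" "p a \<in> A" "p a \<noteq> a" by blast
  then have "\<Sum> {w, a, p a} = w + a + p a" using A(3) by (intro sum_triple) auto
  then show "\<exists>a\<in>A. \<exists>b\<in>A. a \<noteq> b \<and> {w, a, b} \<in> {X. ?N dvd \<Sum> X}"
    using a p(2)[of a] by (intro bexI[of _ a] bexI[of _ "p a"]) auto
qed

text \<open>Each codegree is about a third of \<open>n + m\<close>, which is below \<open>m\<close>
  when \<open>n\<close> and \<open>m\<close> are close and large. If \<open>A\<close> were
  independent in the link of \<open>w\<close>, it would contain at most one element congruent to
  \<open>w\<close> modulo 3, and could not meet both other classes, too few elements for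
  \<open>card A = n\<close>.\<close>

lemma triple_coloring_mod_3:
  assumes "m \<le> n" "n \<le> m + 3" "15 \<le> n"
  shows "triple_coloring n m {X. 3 dvd \<Sum> X}"
proof
  show "3 \<le> n" "1 \<le> m" using assms by auto
next
  fix S :: "nat set" assume S: "S \<subseteq> {1..n + m}" "card S = 2"
  then have "finite S" using finite_subset by auto
  then have "card {z \<in> {1..n + m}. z \<notin> S \<and> insert z S \<in> {X. 3 dvd \<Sum> X}}
      \<le> card {z \<in> {1..n + m}. 3 dvd \<Sum> S + z}"
    by (intro card_mono) (auto simp: add.commute)
  also have "\<dots> \<le> (n + m) div 3 + 2" by (rule card_residue_class_le) simp
  also have "\<dots> < m" using assms by linarith
  finally show "card {z \<in> {1..n + m}. z \<notin> S \<and> insert z S \<in> {X. 3 dvd \<Sum> X}} < m" .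
next
  fix w A assume A: "A \<subseteq> {1..n + m}" "w \<in> {1..n + m}" "w \<notin> A" "card A = n"
  have fA: "finite A" using A(1) finite_subset by auto
  have "\<exists>a\<in>A. \<exists>b\<in>A. a \<noteq> b \<and> 3 dvd w + a + b"
  proof (rule ccontr)
    assume "\<not> ?thesis"
    then have neg: "\<not> 3 dvd w + a + b" if "a \<in> A" "b \<in> A" "a \<noteq> b" for a b
      using that by blast
    \<comment> \<open>Since \<open>2 * a\<close> is congruent to \<open>- a\<close> modulo 3, these
      are the elements of \<open>A\<close> congruent to \<open>w\<close>.\<close>
    define F where "F = {a \<in> A. 3 dvd w + 2 * a}"
    have "\<forall>a\<in>F. \<forall>b\<in>F. a = b"
    proof (intro ballI, rule ccontr)
      fix a b assume ab: "a \<in> F" "b \<in> F" "a \<noteq> b"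
      then have "3 dvd w + 2 * a" "3 dvd w + 2 * b" unfolding F_def by auto
      then have "3 dvd w + a + b" by presburger
      with neg[of a b] ab show False unfolding F_def by auto
    qed
    then have F1: "card F \<le> 1"
      using fA unfolding F_def One_nat_def by (subst card_le_Suc0_iff_eq) auto
    have F2: "card (A - F) \<le> (n + m) div 3 + 2"
    proof (cases "A - F = {}")
      case False
      then obtain a where a: "a \<in> A" "a \<notin> F" by blast
      \<comment> \<open>Here \<open>3 dvd 2 * a + z\<close> expresses that \<open>z\<close> is
        congruent to \<open>a\<close>. Representatives of the two classes other than that of
        \<open>w\<close> would complete \<open>w\<close> to a sum divisible by 3.\<close>
      have "A - F \<subseteq> {z \<in> {1..n + m}. 3 dvd 2 * a + z}"
      proof
        fix b assume b: "b \<in> A - F"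
        have "\<not> 3 dvd w + 2 * a" "\<not> 3 dvd w + 2 * b" using a b unfolding F_def by auto
        moreover have "a \<noteq> b \<longrightarrow> \<not> 3 dvd w + a + b" using neg[of a b] a b by auto
        ultimately have "3 dvd 2 * a + b" by presburger
        then show "b \<in> {z \<in> {1..n + m}. 3 dvd 2 * a + z}" using b A(1) by auto
      qed
      then have "card (A - F) \<le> card {z \<in> {1..n + m}. 3 dvd 2 * a + z}"
        by (intro card_mono) auto
      also have "\<dots> \<le> (n + m) div 3 + 2" by (rule card_residue_class_le) simp
      finally show ?thesis .
    next
      case True
      then show ?thesis by (metis card.empty le0)
    qed
    have "n = card F + card (A - F)"
      using fA A(4) card_Diff_subset[of F A] card_mono[of A F] unfolding F_def by simp
    with F1 F2 assms show False by linarith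
  qed
  then obtain a b where ab: "a \<in> A" "b \<in> A" "a \<noteq> b" "3 dvd w + a + b" by blast
  then have "\<Sum> {w, a, b} = w + a + b" using A(3) by (intro sum_triple) auto
  then show "\<exists>a\<in>A. \<exists>b\<in>A. a \<noteq> b \<and> {w, a, b} \<in> {X. 3 dvd \<Sum> X}"
    using ab by (intro bexI[of _ a] bexI[of _ b]) auto
qed

section \<open>Choice of the modulus and exchange of colours\<close>

theorem theorem5:
  shows "\<exists>n0::nat. \<forall>n\<ge>n0. \<forall>m\<ge>3. \<exists>B R :: nat set set.
    B \<subseteq> boolean_lattice (n + m) \<and> R \<subseteq> boolean_lattice (n + m) \<and>
    B \<inter> R = {} \<and> B \<union> R = boolean_lattice (n + m) \<and>
    \<not> weak_subposet (boolean_lattice m) B \<and>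
    \<not> weak_subposet (boolean_lattice n) R"
\<comment> \<open>The value 15 serves the modulus 3: with \<open>n\<close> at most
  \<open>m + 3\<close> it gives \<open>m\<close> at least 12, so that
  \<open>(n + m) div 3 + 2 < m\<close>.\<close>
proof (intro exI[of _ 15] allI impI)
  fix n m :: nat
  assume n: "15 \<le> n" and m: "3 \<le> m"
  have wlog: "\<exists>B R :: nat set set.
    B \<subseteq> boolean_lattice (k + l) \<and> R \<subseteq> boolean_lattice (k + l) \<and>
    B \<inter> R = {} \<and> B \<union> R = boolean_lattice (k + l) \<and>
    \<not> weak_subposet (boolean_lattice l) B \<and> \<not> weak_subposet (boolean_lattice k) R"
    if "l \<le> k" "15 \<le> k" "3 \<le> l" for k l
  proof (cases "l + 4 \<le> k")
    case True
    then show ?thesis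
      using that by (intro triple_coloring.ex_coloring[OF triple_coloring_mod_sum])
  next
    case False
    then show ?thesis
      using that by (intro triple_coloring.ex_coloring[OF triple_coloring_mod_3]) auto
  qed
  show "\<exists>B R :: nat set set.
    B \<subseteq> boolean_lattice (n + m) \<and> R \<subseteq> boolean_lattice (n + m) \<and>
    B \<inter> R = {} \<and> B \<union> R = boolean_lattice (n + m) \<and>
    \<not> weak_subposet (boolean_lattice m) B \<and>
    \<not> weak_subposet (boolean_lattice n) R"
  proof (cases "m \<le> n")
    case True
    then show ?thesis using wlog[of m n] n m by blast
  next
    case False
    then obtain B R :: "nat set set" where
      "B \<subseteq> boolean_lattice (m + n)" "R \<subseteq> boolean_lattice (m + n)"
      "B \<inter> R = {}" "B \<union> R = boolean_lattice (m + n)"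
      "\<not> weak_subposet (boolean_lattice n) B" "\<not> weak_subposet (boolean_lattice m) R"
      using wlog[of n m] n by auto
    then show ?thesis
      by (intro exI[of _ R] exI[of _ B]) (auto simp: add.commute)
  qed
qed

end
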